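(* Let $\mathbb{F}$ be any field and let $S$ be an $n\times n$ irreducible zero-nonzero pattern that is spectrally arbitrary over $\mathbb{F}$. Then $S$ has at least $2n-1$ entries equal to $*$.
   Context: An $n\times n$ zero-nonzero pattern is an $n\times n$ array whose entries are the symbols $*$ and $0$. A matrix $A$ over a field $\mathbb{F}$ has pattern $S$ if $A_{ij}\neq 0$ exactly for the positions $(i,j)$ with $S_{ij}=*$. The pattern $S$ is spectrally arbitrary over $\mathbb{F}$ if every monic polynomial $f\in\mathbb{F}[t]$ of degree $n$ is the characteristic polynomial of some $n\times n$ matrix with entries in $\mathbb{F}$ and pattern $S$. The pattern $S$ is irreducible if for every partition of $\{1,\ldots,n\}$ into two disjoint nonempty subsets $I,J$ there exist $i\in I$ and $j\in J$ with $S_{ij}=*$. *)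

theory Defs
  imports "Jordan_Normal_Form.Char_Poly"
begin

text \<open>
  Rows and columns of an \<open>n \<times> n\<close> array are indexed by \<open>{0..<n}\<close>, the convention of the
  matrix library, instead of \<open>{1,\<dots>,n}\<close>.
\<close>

datatype symbol = Star | Zero

type_synonym pattern = "symbol mat"

definition has_pattern :: "'a :: field mat \<Rightarrow> pattern \<Rightarrow> bool" where
  "has_pattern A S \<longleftrightarrow>
     dim_row A = dim_row S \<and> dim_col A = dim_col S \<and>
     (\<forall>i < dim_row S. \<forall>j < dim_col S. A $$ (i, j) \<noteq> 0 \<longleftrightarrow> S $$ (i, j) = Star)"

text \<open>The field is the type argument, passed explicitly because it does not occur in the pattern.\<close>

definition spectrally_arbitrary :: "'a :: field itself \<Rightarrow> nat \<Rightarrow> pattern \<Rightarrow> bool" where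
  "spectrally_arbitrary (_ :: 'a itself) n S \<longleftrightarrow>
     (\<forall>f :: 'a poly. monic f \<and> degree f = n \<longrightarrow>
        (\<exists>A \<in> carrier_mat n n. has_pattern A S \<and> char_poly A = f))"

definition irreducible_pattern :: "nat \<Rightarrow> pattern \<Rightarrow> bool" where
  "irreducible_pattern n S \<longleftrightarrow>
     (\<forall>I J. I \<union> J = {0..<n} \<and> I \<inter> J = {} \<and> I \<noteq> {} \<and> J \<noteq> {} \<longrightarrow>
        (\<exists>i \<in> I. \<exists>j \<in> J. S $$ (i, j) = Star))"

definition star_positions :: "pattern \<Rightarrow> (nat \<times> nat) set" where
  "star_positions S = {(i, j). i < dim_row S \<and> j < dim_col S \<and> S $$ (i, j) = Star}"

end

theory Submission
  imports Defs "HOL-Library.Function_Algebras"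
begin

text \<open>
  The digraph of an irreducible pattern contains a spanning tree, and a diagonal similarity turns
  the \<open>n - 1\<close> entries on the tree into ones without changing the characteristic polynomial. The
  remaining \<open>k\<close> nonzero entries thus parametrise, by polynomial functions, all vectors in
  \<open>F\<^sup>n\<close> of characteristic coefficients, and the claim is \<open>n \<le> k\<close>. Over a finite field this is
  counting. Over an infinite field, the \<open>D\<^sup>n\<close> monomials with exponents below \<open>D\<close> in the coefficients
  are linearly independent by surjectivity, but they lie in a space of dimension \<open>O(D\<^sup>k)\<close> of
  polynomial functions of the parameters.
\<close>

section \<open>Polynomial functions\<close>

definition fscale :: "'a::field \<Rightarrow> ('b \<Rightarrow> 'a) \<Rightarrow> 'b \<Rightarrow> 'a" where
  "fscale c f = (\<lambda>x. c * f x)"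

interpretation fn: vector_space "fscale :: 'a::field \<Rightarrow> ('b \<Rightarrow> 'a) \<Rightarrow> 'b \<Rightarrow> 'a"
  by unfold_locales (auto simp: fscale_def fun_eq_iff algebra_simps)

text \<open>Independence of the indexed family forces \<open>g\<close> to be injective, so the bound
  for independent sets transfers from the image to \<open>I\<close>.\<close>

lemma (in vector_space) card_family_le:
  assumes "finite I" "finite T" and span: "\<And>i. i \<in> I \<Longrightarrow> g i \<in> span T"
    and indep: "\<And>u i. (\<Sum>i\<in>I. u i *s g i) = 0 \<Longrightarrow> i \<in> I \<Longrightarrow> u i = 0"
  shows "card I \<le> card T"
proof -
  have inj: "inj_on g I"
  proof (rule inj_onI, rule ccontr)
    fix a b assume ab: "a \<in> I" "b \<in> I" "g a = g b" "a \<noteq> b"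
    \<comment> \<open>The difference of the indicators of \<open>a\<close> and \<open>b\<close>
      encodes the relation \<open>g a - g b = 0\<close>.\<close>
    define u :: "_ \<Rightarrow> 'a" where "u i = (if i = a then 1 else 0) - (if i = b then 1 else 0)" for i
    have "(\<Sum>i\<in>I. u i *s g i) = (\<Sum>i\<in>I. if i = a then g i else 0) - (\<Sum>i\<in>I. if i = b then g i else 0)"
      unfolding sum_subtractf[symmetric] by (intro sum.cong) (auto simp: u_def scale_left_diff_distrib)
    also have "\<dots> = 0"
      using ab \<open>finite I\<close> by simp
    finally show False
      using indep[of u a] ab by (simp add: u_def)
  qed
  have "independent (g ` I)"
  proof (rule independent_if_scalars_zero)
    fix u v assume "(\<Sum>x\<in>g ` I. u x *s x) = 0" and "v \<in> g ` I"
    then show "u v = 0"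
      using indep[of "\<lambda>i. u (g i)"] by (auto simp: sum.reindex[OF inj])
  qed (use \<open>finite I\<close> in simp)
  then have "card (g ` I) \<le> card T"
    using independent_span_bound[OF \<open>finite T\<close>] span by blast
  then show ?thesis
    by (simp add: card_image[OF inj])
qed

lemma sum_fun_apply: "(\<Sum>i\<in>I. f i) x = (\<Sum>i\<in>I. f i x)"
  for f :: "'i \<Rightarrow> 'b \<Rightarrow> 'a::comm_monoid_add"
  by (induction I rule: infinite_finite_induct) auto

text \<open>Multiplication is bilinear, so products of generators decide. The first induction varies
  the right factor for a fixed generator on the left, the second varies the left factor.\<close>

lemma span_mult:
  fixes f g :: "'b \<Rightarrow> 'a::field"
  assumes "f \<in> fn.span A" "g \<in> fn.span B"
    and AB: "\<And>a b. a \<in> A \<Longrightarrow> b \<in> B \<Longrightarrow> a * b \<in> fn.span C"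
  shows "f * g \<in> fn.span C"
proof -
  have mult_g: "a * g \<in> fn.span C" if a: "a \<in> A" for a
    using assms(2)
  proof (induction rule: fn.span_induct_alt)
    case base
    show ?case
      using fn.span_zero[of C] by (simp add: zero_fun_def times_fun_def)
  next
    case (step c x y)
    have "a * (fscale c x + y) = fscale c (a * x) + a * y"
      by (auto simp: fscale_def fun_eq_iff algebra_simps)
    moreover have "fscale c (a * x) + a * y \<in> fn.span C"
      using step AB[OF a] by (intro fn.span_add fn.span_scale)
    ultimately show ?case by metis
  qed
  show ?thesis
    using assms(1)
  proof (induction rule: fn.span_induct_alt)
    case base
    show ?case
      using fn.span_zero[of C] by (simp add: zero_fun_def times_fun_def)
  next
    case (step c x y)
    have "(fscale c x + y) * g = fscale c (x * g) + y * g"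
      by (auto simp: fscale_def fun_eq_iff algebra_simps)
    moreover have "fscale c (x * g) + y * g \<in> fn.span C"
      using step mult_g by (intro fn.span_add fn.span_scale)
    ultimately show ?case by metis
  qed
qed

section \<open>Functions spanned by monomials of bounded exponents\<close>

text \<open>The bound \<open>r\<close> is on each exponent separately, not on the total degree,
  which makes the count a plain power. Extensional exponent functions keep the index set
  finite.\<close>

definition monomials :: "'k set \<Rightarrow> nat \<Rightarrow> (('k \<Rightarrow> 'a::field) \<Rightarrow> 'a) set" where
  "monomials K r = (\<lambda>\<alpha> y. \<Prod>e\<in>K. y e ^ \<alpha> e) ` (K \<rightarrow>\<^sub>E {..r})"

lemma monomialsI:
  assumes "\<And>e. e \<in> K \<Longrightarrow> \<alpha> e \<le> r"
  shows "(\<lambda>y. \<Prod>e\<in>K. y e ^ \<alpha> e) \<in> monomials K r"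
proof -
  have "(\<lambda>y. \<Prod>e\<in>K. y e ^ \<alpha> e) = (\<lambda>y. \<Prod>e\<in>K. y e ^ restrict \<alpha> K e)"
    by (intro ext prod.cong) auto
  moreover have "restrict \<alpha> K \<in> K \<rightarrow>\<^sub>E {..r}"
    using assms by auto
  ultimately show ?thesis
    unfolding monomials_def by blast
qed

lemma finite_monomials: "finite K \<Longrightarrow> finite (monomials K r)"
  unfolding monomials_def by (intro finite_imageI finite_PiE) auto

lemma card_monomials_le:
  assumes "finite K"
  shows "card (monomials K r) \<le> (r + 1) ^ card K"
proof -
  have "card (monomials K r) \<le> card (K \<rightarrow>\<^sub>E {..r})"
    unfolding monomials_def using assms by (intro card_image_le finite_PiE) auto
  also have "\<dots> = (r + 1) ^ card K"
    using assms by (simp add: card_PiE)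
  finally show ?thesis .
qed

definition polyfun :: "'k set \<Rightarrow> nat \<Rightarrow> (('k \<Rightarrow> 'a::field) \<Rightarrow> 'a) set" where
  "polyfun K r = fn.span (monomials K r)"

lemma polyfun_mono:
  assumes "r \<le> s"
  shows "polyfun K r \<subseteq> polyfun K s"
  unfolding polyfun_def
proof (rule fn.span_mono)
  have "K \<rightarrow>\<^sub>E {..r} \<subseteq> K \<rightarrow>\<^sub>E {..s}"
    using assms by (intro PiE_mono) auto
  then show "monomials K r \<subseteq> monomials K s"
    unfolding monomials_def by (rule image_mono)
qed

lemma polyfun_const: "(\<lambda>y. c) \<in> polyfun K r"
proof -
  have "(\<lambda>y. 1) \<in> monomials K r"
    using monomialsI[of K "\<lambda>_. 0" r] by simp
  then have "fscale c (\<lambda>y. 1) \<in> polyfun K r"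
    unfolding polyfun_def by (intro fn.span_scale fn.span_base)
  then show ?thesis
    by (simp add: fscale_def)
qed

lemma polyfun_var:
  fixes K :: "'k set"
  assumes "finite K" "e \<in> K"
  shows "(\<lambda>y :: 'k \<Rightarrow> 'a::field. y e) \<in> polyfun K 1"
proof -
  have eq: "(\<Prod>e'\<in>K. y e' ^ (if e' = e then 1 else 0)) = y e" for y :: "'k \<Rightarrow> 'a"
  proof -
    have "(\<Prod>e'\<in>K. y e' ^ (if e' = e then 1 else 0)) = (\<Prod>e'\<in>K. if e' = e then y e' else 1)"
      by (intro prod.cong) auto
    then show ?thesis using assms by simp
  qed
  have "(\<lambda>y :: 'k \<Rightarrow> 'a. \<Prod>e'\<in>K. y e' ^ (if e' = e then 1 else 0)) \<in> monomials K 1"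
    by (rule monomialsI) simp
  then have "(\<lambda>y :: 'k \<Rightarrow> 'a. y e) \<in> monomials K 1"
    by (simp only: eq)
  then show ?thesis
    unfolding polyfun_def by (rule fn.span_base)
qed

lemma polyfun_sum:
  assumes "\<And>i. i \<in> I \<Longrightarrow> f i \<in> polyfun K r"
  shows "(\<lambda>y. \<Sum>i\<in>I. f i y) \<in> polyfun K r"
proof -
  have "(\<Sum>i\<in>I. f i) \<in> polyfun K r"
    using assms unfolding polyfun_def by (rule fn.span_sum)
  moreover have "(\<Sum>i\<in>I. f i) = (\<lambda>y. \<Sum>i\<in>I. f i y)"
    by (auto simp: sum_fun_apply)
  ultimately show ?thesis by simp
qed

lemma polyfun_mult:
  fixes f g :: "('k \<Rightarrow> 'a::field) \<Rightarrow> 'a"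
  assumes "f \<in> polyfun K r" "g \<in> polyfun K s"
  shows "(\<lambda>y. f y * g y) \<in> polyfun K (r + s)"
proof -
  have "f * g \<in> fn.span (monomials K (r + s))"
  proof (rule span_mult[OF assms[unfolded polyfun_def]])
    fix a b :: "('k \<Rightarrow> 'a) \<Rightarrow> 'a"
    assume "a \<in> monomials K r" "b \<in> monomials K s"
    then obtain \<alpha> \<beta> where ab: "a = (\<lambda>y. \<Prod>e\<in>K. y e ^ \<alpha> e)" "b = (\<lambda>y. \<Prod>e\<in>K. y e ^ \<beta> e)"
      and bounds: "\<alpha> \<in> K \<rightarrow>\<^sub>E {..r}" "\<beta> \<in> K \<rightarrow>\<^sub>E {..s}"
      unfolding monomials_def by blast
    have eq: "a * b = (\<lambda>y. \<Prod>e\<in>K. y e ^ (\<alpha> e + \<beta> e))"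
      by (simp add: ab fun_eq_iff prod.distrib power_add)
    have "\<alpha> e + \<beta> e \<le> r + s" if "e \<in> K" for e
      using bounds that by (intro add_mono) (auto simp: PiE_iff)
    then show "a * b \<in> fn.span (monomials K (r + s))"
      unfolding eq by (intro fn.span_base monomialsI)
  qed
  then show ?thesis
    by (simp add: polyfun_def times_fun_def)
qed

lemma polyfun_prod:
  assumes "finite I" "\<And>i. i \<in> I \<Longrightarrow> f i \<in> polyfun K (d i)"
  shows "(\<lambda>y. \<Prod>i\<in>I. f i y) \<in> polyfun K (\<Sum>i\<in>I. d i)"
  using assms
proof (induction I rule: finite_induct)
  case empty
  show ?case by (simp add: polyfun_const)
next
  case (insert i I)
  then have "(\<lambda>y. f i y * (\<Prod>i\<in>I. f i y)) \<in> polyfun K (d i + (\<Sum>i\<in>I. d i))"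
    by (intro polyfun_mult) auto
  then show ?case using insert.hyps by simp
qed

lemma polyfun_power:
  assumes "f \<in> polyfun K r"
  shows "(\<lambda>y. f y ^ k) \<in> polyfun K (k * r)"
  using polyfun_prod[of "{..<k}" "\<lambda>_. f" K "\<lambda>_. r"] assms by simp

text \<open>Every monomial reads only the coordinates in \<open>K\<close>, and this passes to linear
  combinations. In the finite case it allows parameters to be restricted to
  \<open>K\<close>.\<close>

lemma polyfun_cong:
  assumes "f \<in> polyfun K r" "\<And>e. e \<in> K \<Longrightarrow> y e = y' e"
  shows "f y = f y'"
  using assms(1) unfolding polyfun_def
proof (induction rule: fn.span_induct_alt)
  case base
  show ?case by simp
next
  case (step c g h)
  then have "g y = g y'"
    using assms(2) by (auto simp: monomials_def)
  with step show ?case by (simp add: fscale_def)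
qed

text \<open>The sum of finitely many individual bounds dominates each of them.\<close>

lemma polyfun_uniform_degree:
  assumes "finite I" "\<And>i. i \<in> I \<Longrightarrow> \<exists>r. f i \<in> polyfun K r"
  obtains r where "\<And>i. i \<in> I \<Longrightarrow> f i \<in> polyfun K r"
proof -
  obtain d where d: "\<And>i. i \<in> I \<Longrightarrow> f i \<in> polyfun K (d i)"
    using assms(2) by metis
  have "f i \<in> polyfun K (\<Sum>i\<in>I. d i)" if "i \<in> I" for i
    using d[OF that] polyfun_mono[OF member_le_sum[OF that, of d]] assms(1) by auto
  then show ?thesis using that by blast
qed

section \<open>A polynomial surjection onto affine space needs enough variables\<close>

lemma base_expansion: "(\<Sum>i<n. (m div D ^ i mod D) * D ^ i) = m" if "m < D ^ n" for m D n :: nat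
  using that
proof (induction n arbitrary: m)
  case 0
  then show ?case by simp
next
  case (Suc n)
  \<comment> \<open>Splitting off the lowest digit leaves \<open>m div D\<close>, whose digits are
    the higher digits of \<open>m\<close>.\<close>
  have "m div D < D ^ n"
    using Suc.prems by (simp add: less_mult_imp_div_less mult.commute)
  from Suc.IH[OF this] have "D * (\<Sum>i<n. (m div D div D ^ i mod D) * D ^ i) = D * (m div D)"
    by simp
  moreover have "D * (\<Sum>i<n. (m div D div D ^ i mod D) * D ^ i) =
      (\<Sum>i<n. (m div D ^ Suc i mod D) * D ^ Suc i)"
    unfolding sum_distrib_left by (intro sum.cong) (auto simp: div_mult2_eq mult.left_commute)
  ultimately have "(\<Sum>i<n. (m div D ^ Suc i mod D) * D ^ Suc i) = D * (m div D)"
    by simp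
  then show ?case
    by (simp only: sum.lessThan_Suc_shift) simp
qed

text \<open>With \<open>q\<close> field elements, \<open>q ^ n\<close> targets are hit from at most
  \<open>q ^ card K\<close> points.\<close>

lemma polyfun_surj_finite:
  fixes c :: "nat \<Rightarrow> ('k \<Rightarrow> 'a::field) \<Rightarrow> 'a"
  assumes "finite (UNIV :: 'a set)" and "finite K"
    and poly: "\<And>i. i < n \<Longrightarrow> c i \<in> polyfun K r"
    and surj: "\<And>z. \<exists>y. \<forall>i<n. c i y = z i"
  shows "n \<le> card K"
proof -
  let ?U = "UNIV :: 'a set"
  let ?\<Phi> = "\<lambda>y. restrict (\<lambda>i. c i y) {..<n}"
  have "{..<n} \<rightarrow>\<^sub>E ?U \<subseteq> ?\<Phi> ` (K \<rightarrow>\<^sub>E ?U)"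
  proof
    fix z assume z: "z \<in> {..<n} \<rightarrow>\<^sub>E ?U"
    obtain y where y: "\<forall>i<n. c i y = z i"
      using surj by blast
    have "c i (restrict y K) = z i" if "i < n" for i
      using polyfun_cong[OF poly[OF that], of "restrict y K" y] y that by simp
    then have "z = ?\<Phi> (restrict y K)"
      using z by (auto simp: fun_eq_iff PiE_def extensional_def)
    then show "z \<in> ?\<Phi> ` (K \<rightarrow>\<^sub>E ?U)" by auto
  qed
  then have "card ({..<n} \<rightarrow>\<^sub>E ?U) \<le> card (K \<rightarrow>\<^sub>E ?U)"
    using assms by (intro surj_card_le finite_PiE) auto
  then have "card ?U ^ n \<le> card ?U ^ card K"
    using assms by (simp add: card_PiE)
  \<comment> \<open>Exponents can be compared because the base is at least 2.\<close>
  moreover have "card {0, 1 :: 'a} \<le> card ?U"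
    using assms by (intro card_mono) auto
  ultimately show ?thesis by simp
qed

text \<open>
  The products of powers of the \<open>c i\<close> with exponents below \<open>D\<close> are indexed by the numbers
  below \<open>D ^ n\<close> via their base-\<open>D\<close> digits. At a point with \<open>c i y = t ^ (D ^ i)\<close> the product with
  index \<open>m\<close> takes the value \<open>t ^ m\<close>, so these products are linearly independent.
\<close>

lemma polyfun_surj_infinite:
  fixes c :: "nat \<Rightarrow> ('k \<Rightarrow> 'a::field) \<Rightarrow> 'a"
  assumes inf: "infinite (UNIV :: 'a set)" and "finite K"
    and poly: "\<And>i. i < n \<Longrightarrow> c i \<in> polyfun K r"
    and surj: "\<And>z. \<exists>y. \<forall>i<n. c i y = z i"
  shows "n \<le> card K"
proof (rule ccontr)
  assume "\<not> n \<le> card K"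
  define k where "k = card K"
  have k: "Suc k \<le> n" using \<open>\<not> n \<le> card K\<close> by (simp add: k_def)
  \<comment> \<open>Chosen to exceed \<open>(n * r + 1) ^ k\<close>, so that the monomial count, at
    most \<open>(n * r + 1) ^ k * D ^ k\<close>, stays below
    \<open>D ^ (k + 1) \<le> D ^ n\<close>.\<close>
  define D where "D = (n * r + 1) ^ k + 1"
  define g where "g m = (\<lambda>y. \<Prod>i<n. c i y ^ (m div D ^ i mod D))" for m
  have D: "D \<ge> 1" by (simp add: D_def)
  have curve: "\<exists>y. \<forall>m<D ^ n. g m y = t ^ m" for t
  proof -
    obtain y where y: "\<forall>i<n. c i y = t ^ (D ^ i)"
      using surj[of "\<lambda>i. t ^ (D ^ i)"] by blast
    have "g m y = t ^ m" if m: "m < D ^ n" for m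
    proof -
      have "g m y = (\<Prod>i<n. t ^ ((m div D ^ i mod D) * D ^ i))"
        unfolding g_def using y
        by (intro prod.cong) (auto simp: power_mult[symmetric] mult.commute)
      also have "\<dots> = t ^ (\<Sum>i<n. (m div D ^ i mod D) * D ^ i)"
        by (simp add: power_sum)
      finally show ?thesis by (simp add: base_expansion[OF m])
    qed
    then show ?thesis by blast
  qed
  have indep: "u m = 0"
    if zero: "\<And>y. (\<Sum>m<D ^ n. u m * g m y) = 0" and m: "m < D ^ n" for u m
  proof -
    \<comment> \<open>A linear relation among the products becomes, along the curve, a polynomial
      vanishing at every \<open>t\<close>. Over an infinite field it is zero.\<close>
    define p where "p = (\<Sum>m<D ^ n. monom (u m) m)"
    have "poly p t = 0" for t
    proof -
      obtain y where "\<forall>m<D ^ n. g m y = t ^ m" using curve by blast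
      then show ?thesis
        using zero[of y] by (simp add: p_def poly_sum poly_monom)
    qed
    then have "p = 0"
      using inf poly_roots_finite[of p] by auto
    then have "coeff p m = 0" by simp
    then show ?thesis
      using m by (simp add: p_def coeff_sum)
  qed
  have g_poly: "g m \<in> polyfun K (n * (D * r))" for m
  proof -
    have "(\<lambda>y. c i y ^ (m div D ^ i mod D)) \<in> polyfun K (D * r)" if "i \<in> {..<n}" for i
    proof (rule subsetD[OF polyfun_mono])
      show "(m div D ^ i mod D) * r \<le> D * r"
        using D by (intro mult_le_mono1) (simp add: less_imp_le)
      show "(\<lambda>y. c i y ^ (m div D ^ i mod D)) \<in> polyfun K ((m div D ^ i mod D) * r)"
        using that by (intro polyfun_power poly) simp
    qed
    then have "(\<lambda>y. \<Prod>i<n. c i y ^ (m div D ^ i mod D)) \<in> polyfun K (\<Sum>i<n. D * r)"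
      by (intro polyfun_prod) auto
    then show ?thesis
      by (simp add: g_def)
  qed
  \<comment> \<open>The independent products lie in the span of the monomials, which bounds their
    number.\<close>
  have "card {..<D ^ n} \<le> card (monomials K (n * (D * r)) :: (('k \<Rightarrow> 'a) \<Rightarrow> 'a) set)"
  proof (rule fn.card_family_le[of "{..<D ^ n}" _ g])
    show "finite {..<D ^ n}" by simp
    show "finite (monomials K (n * (D * r)) :: (('k \<Rightarrow> 'a) \<Rightarrow> 'a) set)"
      using \<open>finite K\<close> by (rule finite_monomials)
    show "g m \<in> fn.span (monomials K (n * (D * r)))" for m
      using g_poly by (simp add: polyfun_def)
    fix u m assume sum: "(\<Sum>m<D ^ n. fscale (u m) (g m)) = 0" and m: "m \<in> {..<D ^ n}"
    have "(\<Sum>m<D ^ n. u m * g m y) = 0" for y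
      using fun_cong[OF sum, of y] by (simp add: sum_fun_apply fscale_def)
    with indep[of u m] m show "u m = 0" by simp
  qed
  also have "\<dots> \<le> (n * (D * r) + 1) ^ k"
    using card_monomials_le[OF \<open>finite K\<close>] by (simp add: k_def)
  also have "\<dots> \<le> ((n * r + 1) * D) ^ k"
    using D by (intro power_mono) (auto simp: algebra_simps)
  also have "\<dots> = (n * r + 1) ^ k * D ^ k"
    by (rule power_mult_distrib)
  also have "\<dots> < D * D ^ k"
    using D by (intro mult_strict_right_mono) (auto simp: D_def)
  also have "\<dots> \<le> D ^ n"
    using power_increasing[OF k D] by simp
  finally show False
    by simp
qed

section \<open>Coefficients of the characteristic polynomial\<close>

text \<open>Entries of the characteristic matrix are polynomials in \<open>t\<close> depending on
  parameters \<open>y\<close>; this predicate tracks the dependence on \<open>y\<close> alone. The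
  bound may vary with \<open>j\<close>, since each coefficient of a sum or product involves finitely
  many others.\<close>

definition coeffs_polyfun :: "'k set \<Rightarrow> (('k \<Rightarrow> 'a::field) \<Rightarrow> 'a poly) \<Rightarrow> bool" where
  "coeffs_polyfun K p \<longleftrightarrow> (\<forall>j. \<exists>r. (\<lambda>y. coeff (p y) j) \<in> polyfun K r)"

lemma coeffs_polyfun_const: "coeffs_polyfun K (\<lambda>y. p)"
  unfolding coeffs_polyfun_def using polyfun_const by blast

lemma coeffs_polyfun_sum:
  assumes "finite I" "\<And>i. i \<in> I \<Longrightarrow> coeffs_polyfun K (p i)"
  shows "coeffs_polyfun K (\<lambda>y. \<Sum>i\<in>I. p i y)"
  unfolding coeffs_polyfun_def
proof
  fix j
  obtain r where "\<And>i. i \<in> I \<Longrightarrow> (\<lambda>y. coeff (p i y) j) \<in> polyfun K r"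
    using polyfun_uniform_degree[OF assms(1), of "\<lambda>i y. coeff (p i y) j" K] assms(2)
    unfolding coeffs_polyfun_def by blast
  then have "(\<lambda>y. \<Sum>i\<in>I. coeff (p i y) j) \<in> polyfun K r"
    by (rule polyfun_sum)
  then show "\<exists>r. (\<lambda>y. coeff (\<Sum>i\<in>I. p i y) j) \<in> polyfun K r"
    unfolding coeff_sum by (rule exI)
qed

lemma coeffs_polyfun_mult:
  assumes "coeffs_polyfun K p" "coeffs_polyfun K q"
  shows "coeffs_polyfun K (\<lambda>y. p y * q y)"
  unfolding coeffs_polyfun_def
proof
  fix j
  have "\<exists>r. (\<lambda>y. coeff (p y) i * coeff (q y) (j - i)) \<in> polyfun K r" for i
  proof -
    obtain r s where "(\<lambda>y. coeff (p y) i) \<in> polyfun K r" "(\<lambda>y. coeff (q y) (j - i)) \<in> polyfun K s"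
      using assms unfolding coeffs_polyfun_def by blast
    then show ?thesis
      by (intro exI) (rule polyfun_mult)
  qed
  then obtain r where "\<And>i. i \<in> {..j} \<Longrightarrow> (\<lambda>y. coeff (p y) i * coeff (q y) (j - i)) \<in> polyfun K r"
    using polyfun_uniform_degree[of "{..j}" "\<lambda>i y. coeff (p y) i * coeff (q y) (j - i)" K] by blast
  then have "(\<lambda>y. \<Sum>i\<le>j. coeff (p y) i * coeff (q y) (j - i)) \<in> polyfun K r"
    by (rule polyfun_sum)
  then show "\<exists>r. (\<lambda>y. coeff (p y * q y) j) \<in> polyfun K r"
    unfolding coeff_mult by (rule exI)
qed

lemma coeffs_polyfun_prod:
  assumes "finite I" "\<And>i. i \<in> I \<Longrightarrow> coeffs_polyfun K (p i)"
  shows "coeffs_polyfun K (\<lambda>y. \<Prod>i\<in>I. p i y)"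
  using assms
proof (induction I rule: finite_induct)
  case empty
  show ?case by (simp add: coeffs_polyfun_const)
next
  case (insert i I)
  then have "coeffs_polyfun K (\<lambda>y. p i y * (\<Prod>i\<in>I. p i y))"
    by (intro coeffs_polyfun_mult) auto
  then show ?case using insert.hyps by simp
qed

text \<open>The Leibniz formula builds the determinant from sums and products of entries.\<close>

lemma coeffs_polyfun_det:
  assumes "\<And>y. A y \<in> carrier_mat n n"
    and "\<And>i j. i < n \<Longrightarrow> j < n \<Longrightarrow> coeffs_polyfun K (\<lambda>y. A y $$ (i, j))"
  shows "coeffs_polyfun K (\<lambda>y. det (A y))"
proof -
  have "coeffs_polyfun K
    (\<lambda>y. \<Sum>p\<in>{p. p permutes {0..<n}}. signof p * (\<Prod>i = 0..<n. A y $$ (i, p i)))"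
    using assms(2)
    by (intro coeffs_polyfun_sum coeffs_polyfun_mult coeffs_polyfun_const coeffs_polyfun_prod
        finite_permutations) (auto simp: permutes_in_image)
  then show ?thesis
    by (simp add: det_def'[OF assms(1)])
qed

lemma char_poly_coeff_polyfun:
  assumes A: "\<And>y. A y \<in> carrier_mat n n"
    and entries: "\<And>i j. i < n \<Longrightarrow> j < n \<Longrightarrow> \<exists>r. (\<lambda>y. A y $$ (i, j)) \<in> polyfun K r"
  shows "\<exists>r. (\<lambda>y. coeff (char_poly (A y)) k) \<in> polyfun K r"
proof -
  have "coeffs_polyfun K (\<lambda>y. char_poly_matrix (A y) $$ (i, j))" if ij: "i < n" "j < n" for i j
    unfolding coeffs_polyfun_def
  proof
    fix l
    obtain r where r: "(\<lambda>y. A y $$ (i, j)) \<in> polyfun K r"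
      using entries[OF ij] by blast
    \<comment> \<open>The two summands are the constant contribution of \<open>t\<close> on the
      diagonal and that of minus the matrix entry. Writing them as a sum over \<open>bool\<close>
      makes \<open>polyfun_sum\<close> applicable.\<close>
    have "(\<lambda>y. coeff (char_poly_matrix (A y) $$ (i, j)) l) =
      (\<lambda>y. \<Sum>b\<in>UNIV. if b then (if i = j then coeff [:0, 1:] l else 0)
                       else (if l = 0 then - 1 else 0) * A y $$ (i, j))"
      using carrier_matD[OF A] ij
      by (auto simp: char_poly_matrix_def UNIV_bool fun_eq_iff coeff_pCons split: nat.splits)
    also have "\<dots> \<in> polyfun K (0 + r)"
    proof (rule polyfun_sum)
      fix b :: bool
      show "(\<lambda>y. if b then (if i = j then coeff [:0, 1:] l else 0)
         else (if l = 0 then - 1 else 0) * A y $$ (i, j)) \<in> polyfun K (0 + r)"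
        using polyfun_mult[OF polyfun_const r, of _ 0] polyfun_const by (cases b) auto
    qed
    finally show "\<exists>r. (\<lambda>y. coeff (char_poly_matrix (A y) $$ (i, j)) l) \<in> polyfun K r" by blast
  qed
  then have "coeffs_polyfun K (\<lambda>y. det (char_poly_matrix (A y)))"
    by (rule coeffs_polyfun_det[of _ n, OF char_poly_matrix_closed[OF A]])
  then show ?thesis
    by (simp add: coeffs_polyfun_def char_poly_def)
qed

section \<open>Normalising a spanning tree\<close>

text \<open>The tree grows one vertex at a time along a star leaving \<open>V\<close>, and the
  scaling factor of the new vertex is solved for from the new edge. Quantifying \<open>a\<close>
  after \<open>V\<close> and \<open>T\<close> lets one tree serve all matrices.\<close>

lemma tree_normalisation:
  assumes irr: "irreducible_pattern n S" and "1 \<le> k" "k \<le> n"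
  shows "\<exists>V T. V \<subseteq> {0..<n} \<and> card V = k \<and> T \<subseteq> V \<times> V \<and> (\<forall>e\<in>T. S $$ e = Star) \<and>
    card T = k - 1 \<and>
    (\<forall>a :: nat \<times> nat \<Rightarrow> 'a::field. (\<forall>e\<in>T. a e \<noteq> 0) \<longrightarrow>
      (\<exists>d. (\<forall>i. d i \<noteq> 0) \<and> (\<forall>(i, j)\<in>T. d i * a (i, j) = d j)))"
  using assms(2,3)
proof (induction k rule: dec_induct)
  case base
  have "\<exists>d :: nat \<Rightarrow> 'a. \<forall>i. d i \<noteq> 0" by (rule exI[of _ "\<lambda>_. 1"]) simp
  then show ?case
    using base by (intro exI[of _ "{0}"] exI[of _ "{}"]) auto
next
  case (step k)
  then obtain V T where V: "V \<subseteq> {0..<n}" "card V = k" and T: "T \<subseteq> V \<times> V" "\<forall>e\<in>T. S $$ e = Star"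
      "card T = k - 1"
    and scale: "\<And>a :: nat \<times> nat \<Rightarrow> 'a. (\<forall>e\<in>T. a e \<noteq> 0) \<Longrightarrow>
      \<exists>d. (\<forall>i. d i \<noteq> 0) \<and> (\<forall>(i, j)\<in>T. d i * a (i, j) = d j)"
    by auto
  have "V \<noteq> {}" "{0..<n} - V \<noteq> {}"
    using V step by auto
  \<comment> \<open>Irreducibility for the partition into \<open>V\<close> and its complement gives
    an edge out of \<open>V\<close>.\<close>
  then obtain i j where ij: "i \<in> V" "j \<in> {0..<n} - V" "S $$ (i, j) = Star"
    using irr[unfolded irreducible_pattern_def, rule_format, of V "{0..<n} - V"] V by blast
  have "finite V"
    using V(1) by (rule finite_subset) simp
  moreover have "finite T"
    using T(1) by (rule finite_subset) (simp add: \<open>finite V\<close>)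
  moreover have "(i, j) \<notin> T" using T(1) ij(2) by blast
  ultimately have card: "card (insert j V) = Suc k" "card (insert (i, j) T) = Suc k - 1"
    using ij(2) V(2) T(3) \<open>1 \<le> k\<close> by simp_all
  have "\<exists>d. (\<forall>i. d i \<noteq> 0) \<and> (\<forall>(i', j')\<in>insert (i, j) T. d i' * a (i', j') = d j')"
    if nz: "\<forall>e\<in>insert (i, j) T. a e \<noteq> 0" for a :: "nat \<times> nat \<Rightarrow> 'a"
  proof -
    obtain d where d: "\<forall>i. d i \<noteq> 0" "\<forall>(i, j)\<in>T. d i * a (i, j) = d j"
      using scale[of a] nz by blast
    \<comment> \<open>Since \<open>j\<close> lies outside \<open>V\<close>, no edge of
      \<open>T\<close> touches it, and redefining \<open>d j\<close> preserves the old
      equations.\<close>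
    have "\<forall>(i', j')\<in>insert (i, j) T.
        (d(j := d i * a (i, j))) i' * a (i', j') = (d(j := d i * a (i, j))) j'"
    proof (clarify, elim insertE)
      fix i' j' assume "(i', j') = (i, j)"
      then show "(d(j := d i * a (i, j))) i' * a (i', j') = (d(j := d i * a (i, j))) j'"
        using ij by auto
    next
      fix i' j' assume "(i', j') \<in> T"
      moreover from this have "i' \<noteq> j" "j' \<noteq> j" using T(1) ij(2) by auto
      ultimately show "(d(j := d i * a (i, j))) i' * a (i', j') = (d(j := d i * a (i, j))) j'"
        using d(2) by auto
    qed
    moreover have "\<forall>l. (d(j := d i * a (i, j))) l \<noteq> 0"
      using d(1) nz by auto
    ultimately show ?thesis by (intro exI conjI)
  qed
  moreover have "insert j V \<subseteq> {0..<n}" "insert (i, j) T \<subseteq> insert j V \<times> insert j V"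
    using ij(1,2) V(1) T(1) by auto
  moreover have "\<forall>e\<in>insert (i, j) T. S $$ e = Star"
    using T(2) ij(3) by simp
  ultimately show ?case
    using card by (intro exI[of _ "insert j V"] exI[of _ "insert (i, j) T"] conjI allI impI)
qed

text \<open>This is conjugation by the invertible diagonal matrix with entries \<open>d i\<close>.
  An entry with \<open>d i * A $$ (i, j) = d j\<close> becomes 1.\<close>

lemma char_poly_diagonal_scaling:
  fixes A :: "'a::field mat"
  assumes A: "A \<in> carrier_mat n n" and d: "\<And>i. d i \<noteq> 0"
  shows "char_poly (mat n n (\<lambda>(i, j). d i * A $$ (i, j) / d j)) = char_poly A"
proof -
  let ?B = "mat n n (\<lambda>(i, j). d i * A $$ (i, j) / d j)"
  have eq: "?B = mat_diag n d * A * mat_diag n (\<lambda>i. inverse (d i))"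
    using A by (subst mat_diag_mult_left[OF A], subst mat_diag_mult_right[of _ n])
      (auto simp: divide_inverse)
  have "similar_mat_wit ?B A (mat_diag n d) (mat_diag n (\<lambda>i. inverse (d i)))"
    by (rule similar_mat_witI[OF _ _ eq _ A mat_diag_dim mat_diag_dim]) (use d in simp_all)
  then show ?thesis
    by (intro char_poly_similar) (auto simp: similar_mat_def)
qed

section \<open>Counting the stars on and off the tree\<close>

theorem theorem1:
  fixes n :: nat and S :: pattern
  assumes "S \<in> carrier_mat n n"
    and "irreducible_pattern n S"
    and "spectrally_arbitrary TYPE('a :: field) n S"
  shows "card (star_positions S) \<ge> 2 * n - 1"
proof (cases "n = 0")
  \<comment> \<open>Truncated subtraction makes the bound 0; the tree construction needs at least
    one vertex.\<close>
  case True
  then show ?thesis by simp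
next
  case False
  obtain V T where V: "V \<subseteq> {0..<n}" and T: "T \<subseteq> V \<times> V" "\<forall>e\<in>T. S $$ e = Star" "card T = n - 1"
    and scale: "\<And>a :: nat \<times> nat \<Rightarrow> 'a. (\<forall>e\<in>T. a e \<noteq> 0) \<Longrightarrow>
      \<exists>d. (\<forall>i. d i \<noteq> 0) \<and> (\<forall>(i, j)\<in>T. d i * a (i, j) = d j)"
    using tree_normalisation[OF assms(2), of n, where 'a = 'a] False by auto
  have dims: "dim_row S = n" "dim_col S = n" using assms(1) by auto
  let ?E = "star_positions S"
  have "?E \<subseteq> {0..<n} \<times> {0..<n}"
    by (auto simp: star_positions_def dims)
  then have finE: "finite ?E" using finite_subset by blast
  have TE: "T \<subseteq> ?E"
    using T(1,2) V by (fastforce simp: star_positions_def dims)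
  define K where "K = ?E - T"
  have "finite K" using finE by (simp add: K_def)
  \<comment> \<open>The parameters range over all field values, zero included, so \<open>M y\<close>
    need not have pattern \<open>S\<close>. Only surjectivity onto the coefficients matters.\<close>
  define M :: "(nat \<times> nat \<Rightarrow> 'a) \<Rightarrow> 'a mat" where
    "M y = mat n n (\<lambda>e. if e \<in> T then 1 else if e \<in> K then y e else 0)" for y
  have entries: "\<exists>r. (\<lambda>y. M y $$ (i, j)) \<in> polyfun K r" if "i < n" "j < n" for i j
  proof
    show "(\<lambda>y. M y $$ (i, j)) \<in> polyfun K 1"
      using that polyfun_const[of 1 K 1] polyfun_const[of 0 K 1]
        polyfun_var[OF \<open>finite K\<close>, of "(i, j)"]
      by (cases "(i, j) \<in> T"; cases "(i, j) \<in> K") (simp_all add: M_def)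
  qed
  have carrier: "M y \<in> carrier_mat n n" for y by (simp add: M_def)
  obtain r where r: "\<And>i. i \<in> {..<n} \<Longrightarrow> (\<lambda>y. coeff (char_poly (M y)) i) \<in> polyfun K r"
    using polyfun_uniform_degree[of "{..<n}" "\<lambda>i y. coeff (char_poly (M y)) i" K]
      char_poly_coeff_polyfun[of M n K, OF carrier entries] by blast
  have surj: "\<exists>y. \<forall>i<n. coeff (char_poly (M y)) i = z i" for z
  proof -
    define f where "f = monom 1 n + (\<Sum>i<n. monom (z i) i)"
    have coeff_f: "coeff f i = (if i = n then 1 else if i < n then z i else 0)" for i
      by (simp add: f_def coeff_sum)
    have "degree f = n"
      by (rule antisym) (auto intro: degree_le le_degree simp: coeff_f)
    then have "monic f" "degree f = n" by (simp_all add: coeff_f)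
    then obtain A where A: "A \<in> carrier_mat n n" "has_pattern A S" "char_poly A = f"
      using assms(3) unfolding spectrally_arbitrary_def by blast
    have pat: "A $$ (i, j) \<noteq> 0 \<longleftrightarrow> (i, j) \<in> ?E" if "i < n" "j < n" for i j
      using A(2) that by (auto simp: has_pattern_def star_positions_def dims)
    have "\<forall>e\<in>T. A $$ e \<noteq> 0"
    proof
      fix e assume "e \<in> T"
      then have "e \<in> ?E" using TE by blast
      then show "A $$ e \<noteq> 0"
        using pat[of "fst e" "snd e"] by (auto simp: star_positions_def dims)
    qed
    then obtain d where d: "\<forall>i. d i \<noteq> 0" "\<forall>(i, j)\<in>T. d i * A $$ (i, j) = d j"
      using scale by blast
    \<comment> \<open>The parameters are read off the conjugated matrix: its tree entries are 1 by
      the choice of \<open>d\<close>, and its zeros off the stars persist.\<close>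
    define y where "y = (\<lambda>(i, j). d i * A $$ (i, j) / d j)"
    have "mat n n (\<lambda>(i, j). d i * A $$ (i, j) / d j) = M y"
    proof (rule eq_matI)
      fix i j assume "i < dim_row (M y)" "j < dim_col (M y)"
      then have ij: "i < n" "j < n" by (auto simp: M_def)
      then show "mat n n (\<lambda>(i, j). d i * A $$ (i, j) / d j) $$ (i, j) = M y $$ (i, j)"
        using pat[OF ij] d by (auto simp: M_def K_def y_def)
    qed (auto simp: M_def)
    with char_poly_diagonal_scaling[OF A(1), of d] d(1) A(3) have "char_poly (M y) = f"
      by simp
    then show ?thesis by (intro exI[of _ y]) (simp add: coeff_f)
  qed
  have "n \<le> card K"
  proof (cases "finite (UNIV :: 'a set)")
    case True
    from polyfun_surj_finite[OF True \<open>finite K\<close> r surj] show ?thesis by simp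
  next
    case False
    from polyfun_surj_infinite[OF False \<open>finite K\<close> r surj] show ?thesis by simp
  qed
  \<comment> \<open>As \<open>n\<close> is positive, \<open>n \<le> card ?E - (n - 1)\<close>
    rearranges to the claimed bound even with truncated subtraction.\<close>
  also have "card K = card ?E - (n - 1)"
    using TE finE T(3) by (simp add: K_def card_Diff_subset finite_subset)
  finally show ?thesis by simp
qed

end
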